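(* For any metric measure spaces $X,Y$, any integer $n\ge 1$, and $1\le p<\infty$, $$d_{\mathcal W,p}(\mu_n(X),\mu_n(Y))\le 2\binom n2^{\frac1p}d_{\mathcal{GW},p}(X,Y).$$ If $p=\infty$, $$\widehat d_{\mathcal{GW},\infty}(X,Y)\le d_{\mathcal{GW},\infty}(X,Y).$$
   Context: A metric measure space is $(X,d_X,\mu_X)$ with $(X,d_X)$ compact metric and $\mu_X$ a fully supported Borel probability measure. $\Psi_X^{(n)}:X^n\to\mathbb R^{n\times n}$ sends $(x_1,\dots,x_n)$ to the matrix $(d_X(x_i,x_j))_{i,j}$, and $\mu_n(X):=(\Psi_X^{(n)})_\#\mu_X^{\otimes n}$ is the $n$-th curvature measure. $d_{\mathcal W,p}$ is the $p$-Wasserstein distance between probability measures on $\mathbb R^{n\times n}$ with the $\ell^\infty$ metric; for $p=\infty$ it is the infimum over couplings of the supremum over the support of the coupling of the distance. $\widehat d_{\mathcal{GW},p}(X,Y):=\frac12\sup_{n\in\mathbb N}d_{\mathcal W,p}(\mu_n(X),\mu_n(Y))$. For a coupling $\mu$ of $\mu_X$ and $\mu_Y$ and $1\le p<\infty$, $\mathrm{dis}_p(\mu):=\left(\iint|d_X(x,x')-d_Y(y,y')|^p\,\mu(dx\times dy)\,\mu(dx'\times dy')\right)^{1/p}$, and $\mathrm{dis}_\infty(\mu):=\sup\{|d_X(x,x')-d_Y(y,y')|:(x,y),(x',y')\in\mathrm{supp}(\mu)\}$. $d_{\mathcal{GW},p}(X,Y):=\frac12\inf_\mu\mathrm{dis}_p(\mu)$,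 over all couplings $\mu$. *)

theory Defs
  imports "HOL-Probability.Probability"
begin

text \<open>
  A metric measure space is a measure whose underlying space is a compact subset of some metric
  space type; its metric is the restriction of \<^term>\<open>dist\<close>, its sigma-algebra the
  Borel sigma-algebra of the subspace. Taking the whole type as underlying space is allowed.
\<close>

definition mm_space :: "'a::metric_space measure \<Rightarrow> bool" where
  "mm_space X \<longleftrightarrow>
     prob_space X \<and>
     compact (space X) \<and>
     sets X = sets (restrict_space borel (space X)) \<and>
     (\<forall>U. open U \<longrightarrow> U \<inter> space X \<noteq> {} \<longrightarrow> emeasure X (U \<inter> space X) > 0)"

text \<open>
  Only used for measures on separable metric spaces with their Borel sigma-algebras, so that the
  product sigma-algebra is the Borel sigma-algebra of the product.
\<close>

definition couplings :: "'a measure \<Rightarrow> 'b measure \<Rightarrow> ('a \<times> 'b) measure set" where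
  "couplings M N = {\<gamma>. sets \<gamma> = sets (M \<Otimes>\<^sub>M N) \<and> distr \<gamma> M fst = M \<and> distr \<gamma> N snd = N}"

text \<open>
  Topological support of a measure on a product of two spaces with metrics \<open>d\<close> and \<open>d'\<close>:
  the points all of whose open balls (for the maximum product metric, which induces the product
  topology) have positive measure.
\<close>

definition coupling_support ::
    "('a \<Rightarrow> 'a \<Rightarrow> real) \<Rightarrow> ('b \<Rightarrow> 'b \<Rightarrow> real) \<Rightarrow> ('a \<times> 'b) measure \<Rightarrow> ('a \<times> 'b) set" where
  "coupling_support d d' \<gamma> =
     {z \<in> space \<gamma>. \<forall>e>0.
        emeasure \<gamma> {w \<in> space \<gamma>. d (fst z) (fst w) < e \<and> d' (snd z) (snd w) < e} > 0}"

text \<open>Powers with exponent \<open>a > 0\<close>; the value at infinity is wrong for other exponents.\<close>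

definition ennreal_powr :: "ennreal \<Rightarrow> real \<Rightarrow> ennreal" where
  "ennreal_powr x a = (if x = \<infinity> then \<infinity> else ennreal (enn2real x powr a))"

definition wasserstein ::
    "('a \<Rightarrow> 'a \<Rightarrow> real) \<Rightarrow> real \<Rightarrow> 'a measure \<Rightarrow> 'a measure \<Rightarrow> ennreal" where
  "wasserstein d p M N =
     (INF \<gamma>\<in>couplings M N.
        ennreal_powr (\<integral>\<^sup>+ z. ennreal (d (fst z) (snd z) powr p) \<partial>\<gamma>) (1 / p))"

definition wasserstein_inf ::
    "('a \<Rightarrow> 'a \<Rightarrow> real) \<Rightarrow> 'a measure \<Rightarrow> 'a measure \<Rightarrow> ennreal" where
  "wasserstein_inf d M N =
     (INF \<gamma>\<in>couplings M N. SUP z\<in>coupling_support d d \<gamma>. ennreal (d (fst z) (snd z)))"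

definition distortion ::
    "real \<Rightarrow> ('a::metric_space \<times> 'b::metric_space) measure \<Rightarrow> ennreal" where
  "distortion p \<gamma> =
     ennreal_powr
       (\<integral>\<^sup>+ z. \<integral>\<^sup>+ z'.
          ennreal (\<bar>dist (fst z) (fst z') - dist (snd z) (snd z')\<bar> powr p) \<partial>\<gamma> \<partial>\<gamma>)
       (1 / p)"

definition distortion_inf :: "('a::metric_space \<times> 'b::metric_space) measure \<Rightarrow> ennreal" where
  "distortion_inf \<gamma> =
     (SUP z\<in>coupling_support dist dist \<gamma>. SUP z'\<in>coupling_support dist dist \<gamma>.
        ennreal \<bar>dist (fst z) (fst z') - dist (snd z) (snd z')\<bar>)"

definition GW :: "real \<Rightarrow> 'a::metric_space measure \<Rightarrow> 'b::metric_space measure \<Rightarrow> ennreal" where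
  "GW p X Y = (INF \<gamma>\<in>couplings X Y. distortion p \<gamma>) / 2"

definition GW_inf :: "'a::metric_space measure \<Rightarrow> 'b::metric_space measure \<Rightarrow> ennreal" where
  "GW_inf X Y = (INF \<gamma>\<in>couplings X Y. distortion_inf \<gamma>) / 2"

text \<open>
  Since the size \<open>n\<close> varies inside the statement, real \<open>n \<times> n\<close> matrices are the elements of
  the space of \<open>matrix_borel n\<close>: functions on pairs of indices below \<open>n\<close>, extended by
  \<^term>\<open>undefined\<close>. Points of the \<open>n\<close>-fold power of a space are encoded likewise.
\<close>

definition matrix_borel :: "nat \<Rightarrow> (nat \<times> nat \<Rightarrow> real) measure" where
  "matrix_borel n = (\<Pi>\<^sub>M ij\<in>{..<n} \<times> {..<n}. borel)"

text \<open>The maximum is over a nonempty set only for \<open>n \<ge> 1\<close>; size 0 is never used.\<close>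

definition linf_dist :: "nat \<Rightarrow> (nat \<times> nat \<Rightarrow> real) \<Rightarrow> (nat \<times> nat \<Rightarrow> real) \<Rightarrow> real" where
  "linf_dist n A B = Max ((\<lambda>ij. \<bar>A ij - B ij\<bar>) ` ({..<n} \<times> {..<n}))"

definition distance_matrix :: "nat \<Rightarrow> (nat \<Rightarrow> 'a::metric_space) \<Rightarrow> (nat \<times> nat \<Rightarrow> real)" where
  "distance_matrix n x = (\<lambda>(i, j)\<in>{..<n} \<times> {..<n}. dist (x i) (x j))"

definition curvature_measure ::
    "nat \<Rightarrow> 'a::metric_space measure \<Rightarrow> (nat \<times> nat \<Rightarrow> real) measure" where
  "curvature_measure n X = distr (\<Pi>\<^sub>M i\<in>{..<n}. X) (matrix_borel n) (distance_matrix n)"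

definition GW_hat_inf :: "'a::metric_space measure \<Rightarrow> 'b::metric_space measure \<Rightarrow> ennreal" where
  "GW_hat_inf X Y =
     (SUP n\<in>{1..}. wasserstein_inf (linf_dist n) (curvature_measure n X) (curvature_measure n Y)) / 2"

end

theory Submission
  imports Defs
begin

text \<open>
  A coupling \<open>\<gamma>\<close> of \<open>X\<close> and \<open>Y\<close> induces a coupling of the curvature measures: draw \<open>n\<close> independent
  points from \<open>\<gamma>\<close> and take the two distance matrices. Its transport cost is the expectation of
  a maximum over pairs \<open>i < j\<close>, bounded by the sum of \<open>n choose 2\<close> terms, each equal to
  the \<open>p\<close>-th power of the distortion of \<open>\<gamma>\<close> by independence. For \<open>p = \<infinity>\<close>, almost surely all
  sampled points lie in the support of \<open>\<gamma>\<close>, so no pair of matrices in the support of the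
  induced coupling is further apart than the distortion.
\<close>

section \<open>Countable dense subsets of compact spaces and measurability of the metric\<close>

text \<open>By total boundedness, \<open>S\<close> has a finite net of radius
  \<open>1 / (m + 1)\<close> for every \<open>m\<close>; the union of these nets is countable and
  dense in \<open>S\<close>.\<close>

lemma compact_countable_dense:
  fixes S :: "'a::metric_space set"
  assumes "compact S"
  obtains D where "countable D" "D \<subseteq> S" "\<And>x e. x \<in> S \<Longrightarrow> e > 0 \<Longrightarrow> \<exists>d\<in>D. dist d x < e"
proof -
  have "\<forall>e>0. \<exists>k. finite k \<and> k \<subseteq> S \<and> S \<subseteq> (\<Union>x\<in>k. ball x e)"
    using assms by (intro seq_compact_imp_totally_bounded compact_imp_seq_compact)
  then obtain k where k: "\<And>e::real. e > 0 \<Longrightarrow> finite (k e) \<and> k e \<subseteq> S \<and> S \<subseteq> (\<Union>x\<in>k e. ball x e)"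
    by metis
  let ?D = "\<Union>m. k (inverse (real (Suc m)))"
  show thesis
  proof (rule that)
    show "countable ?D"
      using k by (intro countable_UN[OF countableI_type countable_finite]) simp
    show "?D \<subseteq> S"
      using k by (metis UN_least inverse_positive_iff_positive of_nat_0_less_iff zero_less_Suc)
    fix x :: 'a and e :: real assume "x \<in> S" "e > 0"
    then obtain m where m: "inverse (real (Suc m)) < e"
      using reals_Archimedean by blast
    have "S \<subseteq> (\<Union>y\<in>k (inverse (real (Suc m))). ball y (inverse (real (Suc m))))"
      using k by simp
    then have "\<exists>y\<in>k (inverse (real (Suc m))). dist y x < inverse (real (Suc m))"
      using \<open>x \<in> S\<close> unfolding mem_ball[symmetric] by blast
    then show "\<exists>d\<in>?D. dist d x < e"
      using m by force
  qed
qed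

lemma mm_space_measurable_dist_point:
  assumes "mm_space X"
  shows "dist c \<in> borel_measurable X"
proof -
  have "sets X = sets (restrict_space borel (space X))"
    using assms by (simp add: mm_space_def)
  moreover have "dist c \<in> borel_measurable (restrict_space borel (space X))"
    by (intro measurable_restrict_space1 borel_measurable_continuous_onI continuous_intros)
  ultimately show ?thesis
    using measurable_cong_sets by blast
qed

text \<open>The ambient type need not be second countable, so measurability of the metric on the
  product comes from a countable dense subset \<open>D\<close> of the compact space:
  \<open>dist x y\<close> is the infimum of \<open>dist d x + dist d y\<close> over \<open>d \<in> D\<close>.\<close>

lemma mm_space_measurable_dist:
  assumes X: "mm_space X"
  shows "(\<lambda>z. dist (fst z) (snd z)) \<in> borel_measurable (X \<Otimes>\<^sub>M X)"
proof -
  have "compact (space X)" "prob_space X"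
    using X by (auto simp: mm_space_def)
  then obtain D where D: "countable D" "D \<subseteq> space X"
    and dense: "\<And>x e. x \<in> space X \<Longrightarrow> e > 0 \<Longrightarrow> \<exists>d\<in>D. dist d x < e"
    using compact_countable_dense by metis
  have "D \<noteq> {}"
    using dense prob_space.not_empty[OF \<open>prob_space X\<close>] by (metis all_not_in_conv zero_less_one)
  have [measurable]: "dist c \<in> borel_measurable X" for c
    using X by (rule mm_space_measurable_dist_point)
  have "(\<lambda>z. INF d\<in>D. dist d (fst z) + dist d (snd z)) \<in> borel_measurable (X \<Otimes>\<^sub>M X)"
    using D by (intro borel_measurable_cINF_real) measurable
  moreover have "(INF d\<in>D. dist d x + dist d y) = dist x y" if x: "x \<in> space X" for x y
  proof (rule antisym)
    have bdd: "bdd_below ((\<lambda>d. dist d x + dist d y) ` D)"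
      by (rule bdd_belowI[of _ 0]) auto
    show "(INF d\<in>D. dist d x + dist d y) \<le> dist x y"
    proof (rule field_le_epsilon)
      fix e :: real assume "e > 0"
      \<comment> \<open>The point \<open>d\<close> enters the error twice, since
        \<open>dist d x + dist d y \<le> 2 * dist d x + dist x y\<close>; hence the radius
        \<open>e / 2\<close>.\<close>
      then obtain d where d: "d \<in> D" "dist d x < e / 2"
        using dense[OF x, of "e / 2"] by auto
      have "(INF d\<in>D. dist d x + dist d y) \<le> dist d x + dist d y"
        using bdd d(1) by (rule cINF_lower)
      also have "\<dots> \<le> dist x y + e"
        using dist_triangle[of d y x] d by simp
      finally show "(INF d\<in>D. dist d x + dist d y) \<le> dist x y + e" .
    qed
    show "dist x y \<le> (INF d\<in>D. dist d x + dist d y)"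
      using \<open>D \<noteq> {}\<close> by (rule cINF_greatest) (rule dist_triangle3)
  qed
  ultimately show ?thesis
    by (subst measurable_cong[of _ _ "\<lambda>z. INF d\<in>D. dist d (fst z) + dist d (snd z)"])
      (auto simp: space_pair_measure)
qed

lemma measurable_distance_matrix:
  assumes "mm_space X"
  shows "distance_matrix n \<in> (\<Pi>\<^sub>M i\<in>{..<n}. X) \<rightarrow>\<^sub>M matrix_borel n"
  unfolding distance_matrix_def matrix_borel_def
proof (rule measurable_restrict)
  fix ij assume "ij \<in> {..<n} \<times> {..<n}"
  then obtain i j where ij: "ij = (i, j)" "i < n" "j < n"
    by auto
  have "(\<lambda>x. (x i, x j)) \<in> (\<Pi>\<^sub>M i\<in>{..<n}. X) \<rightarrow>\<^sub>M X \<Otimes>\<^sub>M X"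
    using ij by (intro measurable_Pair measurable_component_singleton) auto
  from measurable_compose[OF this mm_space_measurable_dist[OF assms]]
  show "(\<lambda>x. case ij of (i, j) \<Rightarrow> dist (x i) (x j)) \<in> borel_measurable (\<Pi>\<^sub>M i\<in>{..<n}. X)"
    using ij by simp
qed

section \<open>Basic properties of couplings\<close>

lemma couplings_sets: "\<gamma> \<in> couplings M N \<Longrightarrow> sets \<gamma> = sets (M \<Otimes>\<^sub>M N)"
  by (simp add: couplings_def)

lemma couplings_space: "\<gamma> \<in> couplings M N \<Longrightarrow> space \<gamma> = space M \<times> space N"
  by (metis couplings_sets sets_eq_imp_space_eq space_pair_measure)

lemma couplings_measurable_fst: "\<gamma> \<in> couplings M N \<Longrightarrow> fst \<in> \<gamma> \<rightarrow>\<^sub>M M"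
  using measurable_cong_sets[OF couplings_sets refl] measurable_fst by blast

lemma couplings_measurable_snd: "\<gamma> \<in> couplings M N \<Longrightarrow> snd \<in> \<gamma> \<rightarrow>\<^sub>M N"
  using measurable_cong_sets[OF couplings_sets refl] measurable_snd by blast

lemma couplings_prob_space:
  assumes "\<gamma> \<in> couplings M N" "prob_space M"
  shows "prob_space \<gamma>"
  using assms couplings_measurable_fst[OF assms(1)]
  by (intro prob_space_distrD[of fst \<gamma> M]) (auto simp: couplings_def)

text \<open>The independent coupling shows that couplings exist; this is used for
  \<open>n = 1\<close>, where one coupling is enough to make the cost vanish.\<close>

lemma pair_measure_in_couplings:
  assumes "prob_space M" "prob_space N"
  shows "M \<Otimes>\<^sub>M N \<in> couplings M N"
proof -
  interpret M: prob_space M by fact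
  interpret N: prob_space N by fact
  interpret pair_prob_space M N ..
  have "distr (M \<Otimes>\<^sub>M N) N snd = N"
  proof (rule measure_eqI)
    fix A assume A: "A \<in> sets (distr (M \<Otimes>\<^sub>M N) N snd)"
    then have "A \<in> sets N" by simp
    moreover have "snd -` A \<inter> space (M \<Otimes>\<^sub>M N) = space M \<times> A"
      using sets.sets_into_space[OF \<open>A \<in> sets N\<close>] by (auto simp: space_pair_measure)
    ultimately show "emeasure (distr (M \<Otimes>\<^sub>M N) N snd) A = emeasure N A"
      by (simp add: emeasure_distr M.emeasure_space_1 N.emeasure_pair_measure_Times)
  qed simp
  then show ?thesis
    by (simp add: couplings_def N.distr_pair_fst)
qed

section \<open>The coupling of curvature measures induced by a coupling of the spaces\<close>

text \<open>The operator \<open>compose {..<n}\<close> makes the projected sample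
  \<open>undefined\<close> off \<open>{..<n}\<close>, so that it is a point of the
  \<open>n\<close>-fold product of \<open>X\<close> or \<open>Y\<close>.\<close>

definition matrix_pair ::
    "nat \<Rightarrow> (nat \<Rightarrow> 'a::metric_space \<times> 'b::metric_space) \<Rightarrow> (nat \<times> nat \<Rightarrow> real) \<times> (nat \<times> nat \<Rightarrow> real)"
  where "matrix_pair n \<omega> =
    (distance_matrix n (compose {..<n} fst \<omega>), distance_matrix n (compose {..<n} snd \<omega>))"

definition matrix_coupling ::
    "nat \<Rightarrow> ('a::metric_space \<times> 'b::metric_space) measure \<Rightarrow>
      ((nat \<times> nat \<Rightarrow> real) \<times> (nat \<times> nat \<Rightarrow> real)) measure" where
  "matrix_coupling n \<gamma> =
     distr (\<Pi>\<^sub>M i\<in>{..<n}. \<gamma>) (matrix_borel n \<Otimes>\<^sub>M matrix_borel n) (matrix_pair n)"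

lemma measurable_compose_index:
  assumes "f \<in> M \<rightarrow>\<^sub>M N"
  shows "compose I f \<in> (\<Pi>\<^sub>M i\<in>I. M) \<rightarrow>\<^sub>M (\<Pi>\<^sub>M i\<in>I. N)"
  unfolding compose_def using assms by measurable

lemma measurable_matrix_pair:
  assumes "mm_space X" "mm_space Y" "\<gamma> \<in> couplings X Y"
  shows "matrix_pair n \<in> (\<Pi>\<^sub>M i\<in>{..<n}. \<gamma>) \<rightarrow>\<^sub>M matrix_borel n \<Otimes>\<^sub>M matrix_borel n"
  unfolding matrix_pair_def
  by (intro measurable_Pair
      measurable_compose[OF measurable_compose_index[OF couplings_measurable_fst[OF assms(3)]]
        measurable_distance_matrix[OF assms(1)]]
      measurable_compose[OF measurable_compose_index[OF couplings_measurable_snd[OF assms(3)]]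
        measurable_distance_matrix[OF assms(2)]])

text \<open>Applying \<open>f\<close> to each of \<open>n\<close> independent points with law
  \<open>\<gamma>\<close> gives \<open>n\<close> independent points with law \<open>X\<close>. With
  \<open>f\<close> general, both marginals are covered: \<open>f\<close> is later \<open>fst\<close>
  or, with \<open>Y\<close> in place of \<open>X\<close>, \<open>snd\<close>.\<close>

lemma curvature_measure_distr:
  assumes X: "mm_space X" and f: "f \<in> \<gamma> \<rightarrow>\<^sub>M X" "distr \<gamma> X f = X"
  shows "distr (\<Pi>\<^sub>M i\<in>{..<n}. \<gamma>) (matrix_borel n) (\<lambda>\<omega>. distance_matrix n (compose {..<n} f \<omega>))
    = curvature_measure n X"
proof -
  have "prob_space X"
    using X by (simp add: mm_space_def)
  moreover have "prob_space \<gamma>"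
    using f \<open>prob_space X\<close> by (intro prob_space_distrD[of f \<gamma> X]) auto
  ultimately have "distr (\<Pi>\<^sub>M i\<in>{..<n}. \<gamma>) (\<Pi>\<^sub>M i\<in>{..<n}. X) (compose {..<n} f) = (\<Pi>\<^sub>M i\<in>{..<n}. X)"
    using f by (subst distr_PiM_finite_prob_space') auto
  then have "curvature_measure n X =
      distr (distr (\<Pi>\<^sub>M i\<in>{..<n}. \<gamma>) (\<Pi>\<^sub>M i\<in>{..<n}. X) (compose {..<n} f)) (matrix_borel n)
        (distance_matrix n)"
    by (simp add: curvature_measure_def)
  also have "\<dots> = distr (\<Pi>\<^sub>M i\<in>{..<n}. \<gamma>) (matrix_borel n)
      (\<lambda>\<omega>. distance_matrix n (compose {..<n} f \<omega>))"
    using measurable_distance_matrix[OF X] measurable_compose_index[OF f(1)]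
    by (subst distr_distr) (auto simp: comp_def)
  finally show ?thesis ..
qed

lemma matrix_coupling_in_couplings:
  assumes X: "mm_space X" and Y: "mm_space Y" and \<gamma>: "\<gamma> \<in> couplings X Y"
  shows "matrix_coupling n \<gamma> \<in> couplings (curvature_measure n X) (curvature_measure n Y)"
proof -
  note [measurable] = measurable_matrix_pair[OF assms]
  \<comment> \<open>In \<open>couplings\<close> the marginals have the curvature measures as targets
    of \<open>distr\<close>; only the sigma-algebra of a target matters, and here it is that of
    \<open>matrix_borel n\<close>.\<close>
  have [measurable_cong]: "sets (curvature_measure n X) = sets (matrix_borel n)"
    "sets (curvature_measure n Y) = sets (matrix_borel n)"
    by (simp_all add: curvature_measure_def)
  have "distr (matrix_coupling n \<gamma>) (curvature_measure n X) fst =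
      distr (\<Pi>\<^sub>M i\<in>{..<n}. \<gamma>) (matrix_borel n) (\<lambda>\<omega>. distance_matrix n (compose {..<n} fst \<omega>))"
    unfolding matrix_coupling_def
    by (subst distr_distr) (auto simp: comp_def matrix_pair_def curvature_measure_def intro!: distr_cong)
  moreover have "distr (matrix_coupling n \<gamma>) (curvature_measure n Y) snd =
      distr (\<Pi>\<^sub>M i\<in>{..<n}. \<gamma>) (matrix_borel n) (\<lambda>\<omega>. distance_matrix n (compose {..<n} snd \<omega>))"
    unfolding matrix_coupling_def
    by (subst distr_distr) (auto simp: comp_def matrix_pair_def curvature_measure_def intro!: distr_cong)
  moreover have "sets (matrix_coupling n \<gamma>) = sets (curvature_measure n X \<Otimes>\<^sub>M curvature_measure n Y)"
    by (simp add: matrix_coupling_def curvature_measure_def cong: sets_pair_measure_cong)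
  ultimately show ?thesis
    using curvature_measure_distr[OF X couplings_measurable_fst[OF \<gamma>]]
      curvature_measure_distr[OF Y couplings_measurable_snd[OF \<gamma>]] \<gamma>
    by (simp add: couplings_def)
qed

section \<open>Transport cost of the induced coupling for finite exponents\<close>

abbreviation discrepancy ::
    "'a::metric_space \<times> 'b::metric_space \<Rightarrow> 'a \<times> 'b \<Rightarrow> real" where
  "discrepancy z z' \<equiv> \<bar>dist (fst z) (fst z') - dist (snd z) (snd z')\<bar>"

lemma matrix_pair_entry:
  assumes "i < n" "j < n"
  shows "\<bar>fst (matrix_pair n \<omega>) (i, j) - snd (matrix_pair n \<omega>) (i, j)\<bar> = discrepancy (\<omega> i) (\<omega> j)"
  using assms by (simp add: matrix_pair_def distance_matrix_def compose_def)

lemma linf_dist_attained: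
  assumes "n \<ge> 1"
  obtains i j where "i < n" "j < n" "linf_dist n A B = \<bar>A (i, j) - B (i, j)\<bar>"
proof -
  have "{..<n} \<times> {..<n} \<noteq> {}"
    using assms by (auto simp: lessThan_empty_iff)
  then have "linf_dist n A B \<in> (\<lambda>ij. \<bar>A ij - B ij\<bar>) ` ({..<n} \<times> {..<n})"
    unfolding linf_dist_def by (intro Max_in) auto
  then show thesis
    using that by auto
qed

lemma linf_dist_entry:
  assumes "i < n" "j < n"
  shows "\<bar>A (i, j) - B (i, j)\<bar> \<le> linf_dist n A B"
  unfolding linf_dist_def using assms by (intro Max_ge) auto

text \<open>The maximum is attained at some entry, and its power is a single summand on the right or
  zero: diagonal entries of both matrices vanish and the matrices are symmetric. Summing over
  unordered pairs only is what yields \<open>n choose 2\<close>.\<close>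

lemma linf_dist_powr_le:
  fixes \<omega> :: "nat \<Rightarrow> 'a::metric_space \<times> 'b::metric_space"
  assumes "n \<ge> 1"
  shows "linf_dist n (fst (matrix_pair n \<omega>)) (snd (matrix_pair n \<omega>)) powr p
    \<le> (\<Sum>(j, i)\<in>(SIGMA j:{..<n}. {..<j}). discrepancy (\<omega> i) (\<omega> j) powr p)"
    (is "?l \<le> sum ?f ?S")
proof -
  obtain i j where ij: "i < n" "j < n" "?l = discrepancy (\<omega> i) (\<omega> j) powr p"
    using linf_dist_attained[OF assms] matrix_pair_entry by metis
  have fin: "finite ?S" by auto
  have nonneg: "\<And>x. 0 \<le> ?f x" by (auto split: prod.split)
  consider "i < j" | "i = j" | "j < i" by linarith
  then show ?thesis
  proof cases
    case 1
    then have "?f (j, i) \<le> sum ?f ?S"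
      using ij by (intro member_le_sum fin nonneg) auto
    then show ?thesis using ij by simp
  next
    case 2
    \<comment> \<open>On the diagonal the left side is \<open>0 powr p\<close>, which is
      \<open>0\<close>.\<close>
    then show ?thesis using ij nonneg by (simp add: sum_nonneg)
  next
    case 3
    then have "?f (i, j) \<le> sum ?f ?S"
      using ij by (intro member_le_sum fin nonneg) auto
    \<comment> \<open>Pairs in \<open>?S\<close> have the larger index first, so the summand is the
      one with \<open>i\<close> and \<open>j\<close> exchanged.\<close>
    then show ?thesis using ij by (simp add: dist_commute)
  qed
qed

lemma card_pairs_less: "card (SIGMA j:{..<n}. {..<j}) = n choose 2"
proof -
  have "card (SIGMA j:{..<n}. {..<j}) = (\<Sum>j<n. j)"
    by (subst card_SigmaI) auto
  also have "\<dots> = n choose 2"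
    by (induction n) (auto simp: numeral_2_eq_2)
  finally show ?thesis .
qed

lemma measurable_discrepancy:
  assumes X: "mm_space X" and Y: "mm_space Y" and \<gamma>: "\<gamma> \<in> couplings X Y"
  shows "(\<lambda>z. discrepancy (fst z) (snd z)) \<in> borel_measurable (\<gamma> \<Otimes>\<^sub>M \<gamma>)"
proof -
  note [measurable] = couplings_measurable_fst[OF \<gamma>] couplings_measurable_snd[OF \<gamma>]
  have "(\<lambda>z. (fst (fst z), fst (snd z))) \<in> \<gamma> \<Otimes>\<^sub>M \<gamma> \<rightarrow>\<^sub>M X \<Otimes>\<^sub>M X"
    "(\<lambda>z. (snd (fst z), snd (snd z))) \<in> \<gamma> \<Otimes>\<^sub>M \<gamma> \<rightarrow>\<^sub>M Y \<Otimes>\<^sub>M Y"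
    by measurable
  from measurable_compose[OF this(1) mm_space_measurable_dist[OF X]]
    measurable_compose[OF this(2) mm_space_measurable_dist[OF Y]]
  show ?thesis by simp
qed

text \<open>Distinct coordinates of a product measure are independent, so the pair of them has law
  \<open>M \<Otimes>\<^sub>M M\<close>. The proof goes through the product over the two-element
  index set \<open>{i, j}\<close>, which is the image of the full product under restriction.\<close>

lemma nn_integral_PiM_pair:
  fixes M :: "'a measure" and f :: "'a \<Rightarrow> 'a \<Rightarrow> ennreal"
  assumes "prob_space M" and f: "case_prod f \<in> borel_measurable (M \<Otimes>\<^sub>M M)"
    and I: "finite I" "i \<in> I" "j \<in> I" "i \<noteq> j"
  shows "(\<integral>\<^sup>+\<omega>. f (\<omega> i) (\<omega> j) \<partial>(\<Pi>\<^sub>M i\<in>I. M)) = (\<integral>\<^sup>+x. \<integral>\<^sup>+y. f x y \<partial>M \<partial>M)"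
proof -
  interpret M: prob_space M by fact
  interpret product_prob_space "\<lambda>_. M"
    by unfold_locales
  have [measurable]: "(\<lambda>\<omega>. f (\<omega> i) (\<omega> j)) \<in> borel_measurable (\<Pi>\<^sub>M i\<in>{i, j}. M)"
  proof -
    have "(\<lambda>\<omega>. (\<omega> i, \<omega> j)) \<in> (\<Pi>\<^sub>M i\<in>{i, j}. M) \<rightarrow>\<^sub>M M \<Otimes>\<^sub>M M"
      by (intro measurable_Pair measurable_component_singleton) auto
    from measurable_compose[OF this f] show ?thesis by simp
  qed
  have "(\<integral>\<^sup>+x. \<integral>\<^sup>+y. f x y \<partial>M \<partial>M) = (\<integral>\<^sup>+z. f (fst z) (snd z) \<partial>(M \<Otimes>\<^sub>M M))"
    using M.nn_integral_fst[OF f] by (simp add: case_prod_unfold)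
  also have "\<dots> = (\<integral>\<^sup>+\<omega>. f (\<omega> i) (\<omega> j) \<partial>(\<Pi>\<^sub>M i\<in>{i, j}. M))"
    using f I by (subst product_nn_integral_pair) auto
  also have "\<dots> = (\<integral>\<^sup>+\<omega>. f (\<omega> i) (\<omega> j) \<partial>(\<Pi>\<^sub>M i\<in>I. M))"
    using I by (subst distr_restrict[of "{i, j}" I])
      (auto simp: nn_integral_distr measurable_restrict_subset)
  finally show ?thesis ..
qed

lemma measurable_linf_dist:
  assumes "n \<ge> 1"
  shows "(\<lambda>z. linf_dist n (fst z) (snd z)) \<in> borel_measurable (matrix_borel n \<Otimes>\<^sub>M matrix_borel n)"
proof -
  have ne: "{..<n} \<times> {..<n} \<noteq> {}"
    using assms by (auto simp: lessThan_empty_iff)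
  have "(\<lambda>z. SUP ij\<in>{..<n} \<times> {..<n}. \<bar>fst z ij - snd z ij\<bar>)
      \<in> borel_measurable (matrix_borel n \<Otimes>\<^sub>M matrix_borel n)"
    unfolding matrix_borel_def by (intro borel_measurable_cSUP) (auto intro: countable_finite)
  \<comment> \<open>Maximum and supremum agree because the index set is finite and, as
    \<open>n \<ge> 1\<close>, nonempty.\<close>
  then show ?thesis
    unfolding linf_dist_def using ne by (subst cSup_eq_Max[symmetric]) auto
qed

lemma nn_integral_matrix_coupling_le:
  assumes X: "mm_space X" and Y: "mm_space Y" and \<gamma>: "\<gamma> \<in> couplings X Y" and n: "n \<ge> 1"
  shows "(\<integral>\<^sup>+z. ennreal (linf_dist n (fst z) (snd z) powr p) \<partial>matrix_coupling n \<gamma>)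
    \<le> of_nat (n choose 2) * (\<integral>\<^sup>+z. \<integral>\<^sup>+z'. ennreal (discrepancy z z' powr p) \<partial>\<gamma> \<partial>\<gamma>)"
    (is "_ \<le> _ * ?I")
proof -
  let ?P = "\<Pi>\<^sub>M i\<in>{..<n}. \<gamma>" and ?S = "SIGMA j:{..<n}. {..<j}"
  note [measurable] = measurable_matrix_pair[OF X Y \<gamma>] measurable_linf_dist[OF n]
    measurable_discrepancy[OF X Y \<gamma>]
  have prob: "prob_space \<gamma>"
    using \<gamma> X by (auto simp: mm_space_def intro: couplings_prob_space)
  have meas: "(\<lambda>(z, z'). ennreal (discrepancy z z' powr p)) \<in> borel_measurable (\<gamma> \<Otimes>\<^sub>M \<gamma>)"
    unfolding case_prod_unfold by measurable
  have meas': "(\<lambda>\<omega>. discrepancy (\<omega> i) (\<omega> j) powr p) \<in> borel_measurable ?P"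
    if "i < n" "j < n" for i j
  proof -
    have "(\<lambda>\<omega>. (\<omega> i, \<omega> j)) \<in> ?P \<rightarrow>\<^sub>M \<gamma> \<Otimes>\<^sub>M \<gamma>"
      using that by (intro measurable_Pair measurable_component_singleton) auto
    from measurable_compose[OF this measurable_discrepancy[OF X Y \<gamma>]] show ?thesis by simp
  qed
  have "(\<integral>\<^sup>+z. ennreal (linf_dist n (fst z) (snd z) powr p) \<partial>matrix_coupling n \<gamma>)
      = (\<integral>\<^sup>+\<omega>. ennreal (linf_dist n (fst (matrix_pair n \<omega>)) (snd (matrix_pair n \<omega>)) powr p) \<partial>?P)"
    unfolding matrix_coupling_def by (subst nn_integral_distr) auto
  also have "\<dots> \<le> (\<integral>\<^sup>+\<omega>. (\<Sum>(j, i)\<in>?S. ennreal (discrepancy (\<omega> i) (\<omega> j) powr p)) \<partial>?P)"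
    using linf_dist_powr_le[OF n]
    by (intro nn_integral_mono) (auto simp: case_prod_unfold sum_ennreal intro!: ennreal_leI)
  also have "\<dots> = (\<Sum>(j, i)\<in>?S. \<integral>\<^sup>+\<omega>. ennreal (discrepancy (\<omega> i) (\<omega> j) powr p) \<partial>?P)"
    unfolding case_prod_unfold by (subst nn_integral_sum) (auto intro!: meas')
  \<comment> \<open>Members of \<open>?S\<close> satisfy \<open>i < j\<close>, so the two sampled
    points are independent and every summand has the same value.\<close>
  also have "\<dots> = (\<Sum>(j, i)\<in>?S. ?I)"
    by (intro sum.cong) (auto intro!: nn_integral_PiM_pair[OF prob meas])
  also have "\<dots> = of_nat (n choose 2) * ?I"
    by (simp add: card_pairs_less case_prod_unfold del: card_SigmaI)
  finally show ?thesis .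
qed

section \<open>Powers and infima of extended reals, and the bound for finite exponents\<close>

lemma ennreal_powr_mono: "x \<le> y \<Longrightarrow> 0 \<le> a \<Longrightarrow> ennreal_powr x a \<le> ennreal_powr y a"
  by (auto simp: ennreal_powr_def top_unique less_top intro!: ennreal_leI powr_mono2 enn2real_mono)

lemma ennreal_powr_of_nat_mult:
  assumes "k > 0"
  shows "ennreal_powr (of_nat k * x) a = ennreal (real k powr a) * ennreal_powr x a"
  using assms
  by (auto simp: ennreal_powr_def ennreal_mult_eq_top_iff ennreal_mult_top enn2real_mult powr_mult ennreal_mult)

text \<open>Multiplication by a finite nonzero \<open>c\<close> is undone by division, which gives
  the harder inequality. For empty \<open>I\<close> both sides are \<open>\<top>\<close>, since
  \<open>c \<noteq> 0\<close>.\<close>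

lemma INF_ennreal_mult_left:
  fixes c :: ennreal
  assumes "c \<noteq> 0" "c \<noteq> \<top>"
  shows "(INF i\<in>I. c * f i) = c * (INF i\<in>I. f i)"
proof (rule antisym)
  have "(INF i\<in>I. c * f i) / c \<le> f i" if "i \<in> I" for i
    using assms INF_lower[OF that, of "\<lambda>i. c * f i"]
    by (intro divide_le_posI_ennreal) (auto simp: mult.commute zero_less_iff_neq_zero)
  then have "(INF i\<in>I. c * f i) / c \<le> (INF i\<in>I. f i)"
    by (intro INF_greatest)
  then have "c * ((INF i\<in>I. c * f i) / c) \<le> c * (INF i\<in>I. f i)"
    by (rule mult_left_mono) simp
  then show "(INF i\<in>I. c * f i) \<le> c * (INF i\<in>I. f i)"
    using assms by (simp add: ennreal_times_divide ennreal_mult_divide_eq mult.commute[of c])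
qed (auto intro!: INF_greatest mult_left_mono INF_lower)

lemma wasserstein_curvature_measure_le:
  assumes X: "mm_space X" and Y: "mm_space Y" and n: "n \<ge> 1" and p: "p \<ge> 1"
  shows "wasserstein (linf_dist n) p (curvature_measure n X) (curvature_measure n Y)
    \<le> 2 * ennreal (real (n choose 2) powr (1 / p)) * GW p X Y"
proof -
  let ?W = "wasserstein (linf_dist n) p (curvature_measure n X) (curvature_measure n Y)"
  let ?c = "real (n choose 2) powr (1 / p)"
  have W: "?W \<le> ennreal_powr (of_nat (n choose 2) *
      (\<integral>\<^sup>+z. \<integral>\<^sup>+z'. ennreal (discrepancy z z' powr p) \<partial>\<gamma> \<partial>\<gamma>)) (1 / p)"
    if \<gamma>: "\<gamma> \<in> couplings X Y" for \<gamma>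
    unfolding wasserstein_def using p
    by (intro INF_lower2[OF matrix_coupling_in_couplings[OF X Y \<gamma>]] ennreal_powr_mono
        nn_integral_matrix_coupling_le[OF X Y \<gamma> n]) auto
  show ?thesis
  proof (cases "n choose 2 = 0")
    \<comment> \<open>Here \<open>n = 1\<close>, and the right-hand side is \<open>0\<close>. The
      constant cannot be moved out of the infimum by \<open>INF_ennreal_mult_left\<close>, so the
      bound \<open>W\<close> is applied to a single coupling.\<close>
    case True
    have "X \<Otimes>\<^sub>M Y \<in> couplings X Y"
      using X Y by (intro pair_measure_in_couplings) (auto simp: mm_space_def)
    from W[OF this] True show ?thesis
      by (simp add: ennreal_powr_def)
  next
    case False
    then have c: "?c > 0" by simp
    have "?W \<le> (INF \<gamma>\<in>couplings X Y. ennreal ?c * distortion p \<gamma>)"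
      using W False by (auto simp: ennreal_powr_of_nat_mult distortion_def intro!: INF_greatest)
    also have "\<dots> = ennreal ?c * (INF \<gamma>\<in>couplings X Y. distortion p \<gamma>)"
      using c by (intro INF_ennreal_mult_left) auto
    \<comment> \<open>The factor \<open>2\<close> cancels the one half in the definition of
      \<open>GW\<close>.\<close>
    also have "\<dots> = ennreal ?c * (2 * GW p X Y)"
      unfolding GW_def by (simp add: ennreal_times_divide ennreal_mult_divide_eq mult.commute[of 2])
    finally show ?thesis
      by (simp add: ac_simps)
  qed
qed

section \<open>Supports of couplings and the bound for infinite exponent\<close>

text \<open>A separability argument: the complement of the support is covered by the null boxes
  among countably many.\<close>

lemma AE_coupling_support:
  assumes X: "mm_space X" and Y: "mm_space Y" and \<gamma>: "\<gamma> \<in> couplings X Y"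
  shows "AE w in \<gamma>. w \<in> coupling_support dist dist \<gamma>"
proof -
  have "compact (space X)" "compact (space Y)"
    using X Y by (auto simp: mm_space_def)
  from compact_countable_dense[OF this(1)] compact_countable_dense[OF this(2)]
  obtain D E where D: "countable D" and E: "countable E"
    and denseD: "\<And>x e. x \<in> space X \<Longrightarrow> e > 0 \<Longrightarrow> \<exists>d\<in>D. dist d x < e"
    and denseE: "\<And>y e. y \<in> space Y \<Longrightarrow> e > 0 \<Longrightarrow> \<exists>d\<in>E. dist d y < e"
    by metis
  let ?R = "\<lambda>a b r. {w \<in> space \<gamma>. dist a (fst w) < r \<and> dist b (snd w) < r}"
  have meas: "?R a b r \<in> sets \<gamma>" for a b r
  proof -
    note [measurable] =
      measurable_compose[OF couplings_measurable_fst[OF \<gamma>] mm_space_measurable_dist_point[OF X]]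
      measurable_compose[OF couplings_measurable_snd[OF \<gamma>] mm_space_measurable_dist_point[OF Y]]
    show ?thesis by measurable
  qed
  let ?r = "\<lambda>k. inverse (real (Suc k))"
  have null: "AE w in \<gamma>. emeasure \<gamma> (?R a b r) = 0 \<longrightarrow> w \<notin> ?R a b r" for a b r
    using AE_not_in[of "?R a b r" \<gamma>] meas[where a = a and b = b and r = r]
    by (cases "emeasure \<gamma> (?R a b r) = 0") (auto simp: null_sets_def)
  have "countable (D \<times> E \<times> (UNIV :: nat set))"
    using D E by simp
  then have "AE w in \<gamma>. \<forall>(a, b, k)\<in>D \<times> E \<times> UNIV.
      emeasure \<gamma> (?R a b (?r k)) = 0 \<longrightarrow> w \<notin> ?R a b (?r k)"
    unfolding case_prod_unfold using null by (subst AE_ball_countable) blast+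
  with AE_space show ?thesis
  proof eventually_elim
    case (elim w)
    have "emeasure \<gamma> (?R (fst w) (snd w) e) > 0" if "e > 0" for e
    proof -
      \<comment> \<open>With radius below \<open>e / 2\<close>, a box that contains \<open>w\<close>
        lies in the box of radius \<open>e\<close> around \<open>w\<close>, wherever its centre
        is.\<close>
      obtain k where k: "?r k < e / 2"
        using reals_Archimedean[of "e / 2"] \<open>e > 0\<close> by auto
      have "fst w \<in> space X" "snd w \<in> space Y"
        using elim couplings_space[OF \<gamma>] by auto
      then obtain a b where ab: "a \<in> D" "b \<in> E" "dist a (fst w) < ?r k" "dist b (snd w) < ?r k"
        using denseD[of "fst w" "?r k"] denseE[of "snd w" "?r k"] by auto
      \<comment> \<open>The point \<open>w\<close> lies in this box but in no null box of the
        countable family, so the box is not null.\<close>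
      then have "emeasure \<gamma> (?R a b (?r k)) > 0"
        using elim by (fastforce simp: zero_less_iff_neq_zero)
      also have "emeasure \<gamma> (?R a b (?r k)) \<le> emeasure \<gamma> (?R (fst w) (snd w) e)"
      proof (intro emeasure_mono meas subsetI)
        fix v assume "v \<in> ?R a b (?r k)"
        then show "v \<in> ?R (fst w) (snd w) e"
          using ab k dist_triangle3[of "fst w" "fst v" a] dist_triangle3[of "snd w" "snd v" b]
          by simp
      qed
      finally show ?thesis .
    qed
    then show ?case
      using elim by (simp add: coupling_support_def)
  qed
qed

text \<open>If a support point were a pair of matrices further apart than the distortion, then so
  would be all pairs in a small ball around it. Almost surely the sampled pair is not of this kind,
  so the ball would be null, contrary to the definition of the support.\<close>

lemma wasserstein_inf_curvature_measure_le:
  assumes X: "mm_space X" and Y: "mm_space Y" and \<gamma>: "\<gamma> \<in> couplings X Y" and n: "n \<ge> 1"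
  shows "wasserstein_inf (linf_dist n) (curvature_measure n X) (curvature_measure n Y)
    \<le> distortion_inf \<gamma>"
proof -
  let ?P = "\<Pi>\<^sub>M i\<in>{..<n}. \<gamma>" and ?M = "matrix_coupling n \<gamma>"
  note meas = measurable_matrix_pair[OF X Y \<gamma>]
  have prob: "prob_space \<gamma>"
    using \<gamma> X by (auto simp: mm_space_def intro: couplings_prob_space)
  have AE_bound: "AE \<omega> in ?P. \<forall>i\<in>{..<n}. \<omega> i \<in> coupling_support dist dist \<gamma>"
    using prob by (intro AE_finite_allI AE_PiM_component AE_coupling_support[OF X Y \<gamma>]) auto
  have "ennreal (linf_dist n (fst z) (snd z)) \<le> distortion_inf \<gamma>"
    if z: "z \<in> coupling_support (linf_dist n) (linf_dist n) ?M" for z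
  proof (rule ccontr)
    assume contr: "\<not> ?thesis"
    obtain i j where ij: "i < n" "j < n" "linf_dist n (fst z) (snd z) = \<bar>fst z (i, j) - snd z (i, j)\<bar>"
      using linf_dist_attained[OF n] by metis
    obtain K where K: "distortion_inf \<gamma> = ennreal K" "K \<ge> 0"
      using contr by (cases "distortion_inf \<gamma>") auto
    \<comment> \<open>Half the gap: moving each of the two matrices by less than \<open>e\<close>
      changes the difference at entry \<open>(i, j)\<close> by less than \<open>2 * e\<close>, so it
      stays above \<open>K\<close>.\<close>
    define e where "e = (linf_dist n (fst z) (snd z) - K) / 2"
    have "e > 0"
      using contr K by (simp add: e_def ennreal_le_iff)
    let ?U = "{w \<in> space ?M. linf_dist n (fst z) (fst w) < e \<and> linf_dist n (snd z) (snd w) < e}"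
    have pos: "emeasure ?M ?U > 0"
      using z \<open>e > 0\<close> by (simp add: coupling_support_def)
    \<comment> \<open>Non-measurable sets have \<open>emeasure\<close> zero by convention, so
      positivity already gives measurability of the ball.\<close>
    then have U: "?U \<in> sets (matrix_borel n \<Otimes>\<^sub>M matrix_borel n)"
      using emeasure_notin_sets[of ?U ?M] by (force simp: matrix_coupling_def)
    have "AE \<omega> in ?P. matrix_pair n \<omega> \<notin> ?U"
      using AE_bound
    proof eventually_elim
      case (elim \<omega>)
      have "ennreal (discrepancy (\<omega> i) (\<omega> j)) \<le> distortion_inf \<gamma>"
        unfolding distortion_inf_def using elim ij by (intro SUP_upper2[of "\<omega> i"] SUP_upper) auto
      then have "discrepancy (\<omega> i) (\<omega> j) \<le> K"
        using K by (simp add: ennreal_le_iff)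
      then show ?case
        using matrix_pair_entry[OF ij(1,2), of \<omega>] ij(3)
          linf_dist_entry[OF ij(1,2), of "fst z" "fst (matrix_pair n \<omega>)"]
          linf_dist_entry[OF ij(1,2), of "snd z" "snd (matrix_pair n \<omega>)"]
        unfolding e_def by auto
    qed
    then have "emeasure ?P (matrix_pair n -` ?U \<inter> space ?P) = 0"
      by (subst (asm) AE_iff_measurable[OF measurable_sets[OF meas U]]) auto
    then have "emeasure ?M ?U = 0"
      unfolding matrix_coupling_def using emeasure_distr[OF meas U]
      by (simp add: matrix_coupling_def)
    with pos show False by simp
  qed
  then show ?thesis
    unfolding wasserstein_inf_def
    by (intro INF_lower2[OF matrix_coupling_in_couplings[OF X Y \<gamma>]] SUP_least)
qed

theorem theorem3p8:
  fixes X :: "'a::metric_space measure" and Y :: "'b::metric_space measure"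
  assumes "mm_space X" and "mm_space Y"
  shows "(\<forall>(n::nat) (p::real). n \<ge> 1 \<longrightarrow> p \<ge> 1 \<longrightarrow>
            wasserstein (linf_dist n) p (curvature_measure n X) (curvature_measure n Y)
              \<le> 2 * ennreal (real (n choose 2) powr (1 / p)) * GW p X Y) \<and>
         GW_hat_inf X Y \<le> GW_inf X Y"
proof (intro conjI allI impI)
  \<comment> \<open>The bound holds for each size \<open>n \<ge> 1\<close> and each coupling, so the
    supremum may be taken on the left and the infimum on the right; both definitions carry the same
    factor one half.\<close>
  show "GW_hat_inf X Y \<le> GW_inf X Y"
    unfolding GW_hat_inf_def GW_inf_def
    using wasserstein_inf_curvature_measure_le[OF assms]
    by (intro divide_right_mono_ennreal SUP_least INF_greatest) auto
qed (rule wasserstein_curvature_measure_le[OF assms])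

end
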